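(* For any $q \geq 1$ and any permutation $\pi$ of $q$ symbols, the rotated odometer $F_\pi:I\to I$ has topological entropy $h_{top}(F_\pi) = 0$.
   Context: Let $I=[0,1)$. The von Neumann–Kakutani map $\mathfrak a: I\to I$ is $\mathfrak a(x)=x-(1-3\cdot 2^{-n})$ for $x\in[1-2^{1-n},1-2^{-n})$, $n\ge 1$. For a permutation $\pi$ of $\{0,\dots,q-1\}$, $R_\pi:I\to I$ maps each interval $[\frac iq,\frac{i+1}q)$ by a translation onto $[\frac{\pi(i)}q,\frac{\pi(i)+1}q)$. The rotated odometer is $F_\pi=\mathfrak a\circ R_\pi$. Since $F_\pi$ is discontinuous, topological entropy is understood in Bowen's sense: $h_{top}(F_\pi)=\lim_{\epsilon\to0}\limsup_{n\to\infty}\frac1n\log s(n,\epsilon)$, where $s(n,\epsilon)$ is the maximal cardinality of a set $E\subset I$ such that any two distinct $x,y\in E$ satisfy $|F_\pi^j(x)-F_\pi^j(y)|>\epsilon$ for some $0\le j<n$. *)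

theory Defs
  imports "HOL-Analysis.Analysis"
begin

text \<open>All maps below are meant on the half-open unit interval \<open>I = {0..<1}\<close>; as total functions on
  the reals their values outside \<open>I\<close> are irrelevant.\<close>

text \<open>For \<open>x \<in> I\<close> there is exactly one \<open>n \<ge> 1\<close> with
  \<open>x \<in> {1 - 2 * 2^(-n) ..< 1 - 2^(-n)}\<close>, so the definite description is proper there.\<close>

definition kakutani :: "real \<Rightarrow> real" where
  "kakutani x =
     (let n = (THE n::nat. 1 \<le> n \<and> x \<in> {1 - 2 / 2 ^ n ..< 1 - 1 / 2 ^ n})
      in x - (1 - 3 / 2 ^ n))"

text \<open>\<open>\<lfloor>q x\<rfloor>\<close> is the index \<open>i\<close> of the interval \<open>{i/q ..< (i+1)/q}\<close> containing \<open>x\<close>.\<close>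

definition interval_perm :: "nat \<Rightarrow> (nat \<Rightarrow> nat) \<Rightarrow> real \<Rightarrow> real" where
  "interval_perm q \<pi> x =
     (let i = nat \<lfloor>real q * x\<rfloor> in x + (real (\<pi> i) / real q - real i / real q))"

definition rotated_odometer :: "nat \<Rightarrow> (nat \<Rightarrow> nat) \<Rightarrow> real \<Rightarrow> real" where
  "rotated_odometer q \<pi> = kakutani \<circ> interval_perm q \<pi>"

definition orbit_separated ::
    "'a::metric_space set \<Rightarrow> ('a \<Rightarrow> 'a) \<Rightarrow> nat \<Rightarrow> real \<Rightarrow> 'a set \<Rightarrow> bool" where
  "orbit_separated X f n \<epsilon> E \<longleftrightarrow>
     E \<subseteq> X \<and> (\<forall>x\<in>E. \<forall>y\<in>E. x \<noteq> y \<longrightarrow> (\<exists>j<n. dist ((f ^^ j) x) ((f ^^ j) y) > \<epsilon>))"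

text \<open>Every subset of a separated set is separated, so the supremum over the finite separated
  sets is the maximal cardinality, and is \<open>\<infinity>\<close> if there are arbitrarily large ones (this does
  not happen when \<open>X\<close> is totally bounded).\<close>

definition max_separated ::
    "'a::metric_space set \<Rightarrow> ('a \<Rightarrow> 'a) \<Rightarrow> nat \<Rightarrow> real \<Rightarrow> enat" where
  "max_separated X f n \<epsilon> = (SUP E\<in>{E. finite E \<and> orbit_separated X f n \<epsilon> E}. enat (card E))"

definition ln_enat :: "enat \<Rightarrow> ereal" where
  "ln_enat s = (case s of enat k \<Rightarrow> if k = 0 then - \<infinity> else ereal (ln (real k)) | \<infinity> \<Rightarrow> \<infinity>)"

definition separated_growth ::
    "'a::metric_space set \<Rightarrow> ('a \<Rightarrow> 'a) \<Rightarrow> real \<Rightarrow> ereal" where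
  "separated_growth X f \<epsilon> = limsup (\<lambda>n. ereal (1 / real n) * ln_enat (max_separated X f n \<epsilon>))"

definition bowen_entropy :: "'a::metric_space set \<Rightarrow> ('a \<Rightarrow> 'a) \<Rightarrow> ereal" where
  "bowen_entropy X f = Lim (at_right 0) (separated_growth X f)"

text \<open>The following facts justify the choices above: the description in \<^const>\<open>kakutani\<close> picks
  the intended index, the maps preserve \<open>I\<close>, and the limit in \<^const>\<open>bowen_entropy\<close> always
  exists.\<close>

lemma kakutani_eq:
  assumes "1 \<le> n" and x: "x \<in> {1 - 2 / 2 ^ n ..< 1 - 1 / 2 ^ n}"
  shows "kakutani x = x - (1 - 3 / 2 ^ n)"
proof -
  have aux: False
    if "a < b" "z \<in> {1 - 2 / 2 ^ a ..< 1 - 1 / 2 ^ a}" "z \<in> {1 - 2 / 2 ^ b ..< 1 - 1 / 2 ^ b}"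
    for a b :: nat and z :: real
  proof -
    have "(2::real) ^ Suc a \<le> 2 ^ b" using that(1) by (intro power_increasing) auto
    hence "2 / (2::real) ^ b \<le> 2 / 2 ^ Suc a" by (intro divide_left_mono) auto
    thus False using that(2,3) by simp
  qed
  have "(THE n::nat. 1 \<le> n \<and> x \<in> {1 - 2 / 2 ^ n ..< 1 - 1 / 2 ^ n}) = n"
  proof (rule the_equality)
    fix m :: nat assume "1 \<le> m \<and> x \<in> {1 - 2 / 2 ^ m ..< 1 - 1 / 2 ^ m}"
    thus "m = n" using aux[of m n] aux[of n m] x by (cases m n rule: linorder_cases) blast+
  qed (use assms in blast)
  thus ?thesis by (simp add: kakutani_def)
qed

lemma kakutani_index_exists:
  fixes x :: real
  assumes "x \<in> {0..<1}"
  shows "\<exists>n\<ge>1. x \<in> {1 - 2 / 2 ^ n ..< 1 - 1 / 2 ^ (n::nat)}"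
proof -
  define P where "P = (\<lambda>n::nat. x < 1 - 1 / 2 ^ n)"
  obtain m :: nat where "(1/2) ^ m < 1 - x"
    using real_arch_pow_inv[of "1 - x" "1/2"] assms by auto
  hence m: "P m" by (simp add: P_def power_one_over)
  have n: "P (LEAST n. P n)" using m by (rule LeastI)
  have "\<not> P 0" using assms by (simp add: P_def)
  then obtain k where k: "(LEAST n. P n) = Suc k" using n by (metis not0_implies_Suc)
  hence "\<not> P k" by (metis lessI not_less_Least)
  thus ?thesis using n k by (intro exI[of _ "Suc k"]) (auto simp: P_def)
qed

lemma kakutani_in_I: "x \<in> {0..<1} \<Longrightarrow> kakutani x \<in> {0..<1}"
proof -
  assume "x \<in> {0..<1}"
  then obtain n :: nat where n: "n \<ge> 1" "x \<in> {1 - 2 / 2 ^ n ..< 1 - 1 / 2 ^ n}"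
    using kakutani_index_exists by blast
  define t where "t = 1 / (2::real) ^ n"
  have "(2::real) ^ 1 \<le> 2 ^ n" using n(1) by (intro power_increasing) auto
  hence "2 * t \<le> 1" and "0 < t" by (simp_all add: t_def)
  moreover have "1 - 2 * t \<le> x" "x < 1 - t" "kakutani x = x - (1 - 3 * t)"
    using n(2) kakutani_eq[OF n] by (simp_all add: t_def)
  ultimately show ?thesis by auto
qed

lemma interval_perm_eq:
  assumes "q \<ge> 1" "x \<in> {real i / real q ..< (real i + 1) / real q}"
  shows "interval_perm q \<pi> x = x + (real (\<pi> i) / real q - real i / real q)"
proof -
  have "\<lfloor>real q * x\<rfloor> = int i"
    using assms by (intro floor_unique) (auto simp: field_simps)
  thus ?thesis by (simp add: interval_perm_def)
qed

lemma rotated_odometer_in_I: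
  assumes "q \<ge> 1" "\<pi> permutes {0..<q}" "x \<in> {0..<1}"
  shows "rotated_odometer q \<pi> x \<in> {0..<1}"
proof -
  define i where "i = nat \<lfloor>real q * x\<rfloor>"
  have q: "real q > 0" using assms(1) by simp
  have nn: "0 \<le> real q * x" using assms(3) by simp
  have fl: "real i \<le> real q * x" "real q * x < real i + 1"
    using of_nat_floor[OF nn] floor_correct[of "real q * x"] nn unfolding i_def by linarith+
  have "real q * x < real q * 1" using assms(3) q by (intro mult_strict_left_mono) auto
  hence "i < q" using fl(1) by linarith
  hence "\<pi> i < q" using permutes_in_image[OF assms(2), of i] by simp
  hence *: "real (\<pi> i) + 1 \<le> real q" by linarith
  define y where "y = real q * x - real i + real (\<pi> i)"
  have "interval_perm q \<pi> x = x + (real (\<pi> i) / real q - real i / real q)"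
    unfolding interval_perm_def Let_def i_def ..
  also have "\<dots> = y / real q"
    using q by (simp add: y_def add_divide_distrib diff_divide_distrib)
  finally have "interval_perm q \<pi> x = y / real q" .
  moreover have "0 \<le> y" "y < real q" unfolding y_def using fl * by linarith+
  ultimately have "interval_perm q \<pi> x \<in> {0..<1}" using q by simp
  thus ?thesis unfolding rotated_odometer_def comp_def by (rule kakutani_in_I)
qed

lemma separated_growth_antimono:
  assumes "\<delta> \<le> \<epsilon>"
  shows "separated_growth X f \<epsilon> \<le> separated_growth X f \<delta>"
proof -
  have "max_separated X f n \<epsilon> \<le> max_separated X f n \<delta>" for n
    unfolding max_separated_def
  proof (rule SUP_subset_mono)
    show "{E. finite E \<and> orbit_separated X f n \<epsilon> E} \<subseteq> {E. finite E \<and> orbit_separated X f n \<delta> E}"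
      using assms unfolding orbit_separated_def by (smt (verit) Collect_mono)
  qed simp
  moreover have "ln_enat s \<le> ln_enat t" if "s \<le> t" for s t
    using that by (auto simp: ln_enat_def split: enat.splits)
  ultimately show ?thesis
    unfolding separated_growth_def
    by (intro Limsup_mono always_eventually allI ereal_mult_left_mono) auto
qed

lemma bowen_entropy_tendsto:
  "(separated_growth X f \<longlongrightarrow> bowen_entropy X f) (at_right 0)"
proof -
  have "(separated_growth X f \<longlongrightarrow> (SUP \<epsilon>\<in>{0<..}. separated_growth X f \<epsilon>)) (at_right 0)"
  proof (rule order_tendstoI)
    fix a assume "a < (SUP \<epsilon>\<in>{0<..}. separated_growth X f \<epsilon>)"
    then obtain \<epsilon> where e: "\<epsilon> > 0" "a < separated_growth X f \<epsilon>" by (auto simp: less_SUP_iff)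
    have "a < separated_growth X f \<delta>" if "\<delta> < \<epsilon>" for \<delta>
      using separated_growth_antimono[of \<delta> \<epsilon> X f] that e(2) by auto
    thus "\<forall>\<^sub>F \<delta> in at_right 0. a < separated_growth X f \<delta>"
      using e(1) by (auto simp: eventually_at_right_field)
  next
    fix a assume a: "(SUP \<epsilon>\<in>{0<..}. separated_growth X f \<epsilon>) < a"
    have "separated_growth X f \<delta> < a" if "\<delta> > 0" for \<delta>
      using a that by (meson SUP_upper greaterThan_iff order_le_less_trans)
    thus "\<forall>\<^sub>F \<delta> in at_right 0. separated_growth X f \<delta> < a"
      using eventually_at_right_less[of "0::real"] by (auto elim: eventually_mono)
  qed
  moreover from this have "bowen_entropy X f = (SUP \<epsilon>\<in>{0<..}. separated_growth X f \<epsilon>)"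
    unfolding bowen_entropy_def by (intro tendsto_Lim) simp_all
  ultimately show ?thesis by simp
qed

end

theory Submission
  imports Defs
begin

text \<open>
  A rotated odometer is deterministic on a fine grid except on a small set that every orbit visits
  rarely. Write \<open>F = \<kappa> \<circ> R\<close> with \<open>\<kappa>\<close> the Kakutani map and \<open>R\<close> the interval permutation, fix \<open>N\<close>,
  and cut \<open>I\<close> into the \<open>M = q 2\<^sup>N\<close> intervals of length \<open>1/M\<close>. The map \<open>R\<close> permutes these cells, and
  \<open>\<kappa>\<close> translates each cell below \<open>1 - 2\<^bsup>-N\<^esup>\<close> onto another cell. So outside the set \<open>B\<close>
  of points with \<open>R x \<ge> 1 - 2\<^bsup>-N\<^esup>\<close> the cell of \<open>x\<close> determines the cell of \<open>F x\<close>. On \<open>B\<close> it does not,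
  but there \<open>\<kappa>\<close> maps into \<open>{0..<2\<^bsup>-N\<^esup>}\<close>, so that \<open>F x\<close> lies in one of the first \<open>q\<close> cells.

  The point is that a visit to \<open>B\<close> is followed by a long excursion. Every map involved is a
  translation on a short interval to the right of each point of \<open>I\<close>. Given \<open>h\<close>, the iterates
  \<open>R \<circ> F\<^sup>j\<close> with \<open>j < h\<close> are therefore translations on a common interval \<open>{0..<\<delta>}\<close>, and since their
  values at \<open>0\<close> are less than \<open>1\<close>, their values on this interval stay away from \<open>1\<close>
  (\<open>long_excursion_from_origin\<close>). For large \<open>N\<close> a point of \<open>{0..<2\<^bsup>-N\<^esup>}\<close> thus avoids \<open>B\<close> during \<open>h\<close>
  steps, and two visits to \<open>B\<close> are at least \<open>h\<close> steps apart.

  Hence the grid itinerary of length \<open>n\<close> is fixed by the initial cell and one of \<open>q\<close> choices for each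
  block of \<open>h\<close> consecutive times. If \<open>1/M \<le> \<epsilon>\<close>, points with the same itinerary are not
  \<open>\<epsilon>\<close>-separated, so there are at most \<open>M q\<^bsup>n div h + 1\<^esup>\<close> separated points
  (\<open>card_separated_le_of_rare_choices\<close>) and the growth rate is at most \<open>ln q / h\<close>
  (\<open>separated_growth_rotated_odometer_le\<close>). As \<open>h\<close> is arbitrary, it vanishes.
\<close>

section \<open>Entropy of maps coded with rare finite choices\<close>

text \<open>
  The set \<open>B\<close> collects the points whose next code is a genuine choice. By \<open>gap\<close> an orbit meets \<open>B\<close> at
  most once in each time block \<open>{i h ..< (i + 1) h}\<close>, so recording the code right after that visit
  for each block, together with the initial code, lets one recover all codes up to time \<open>n\<close> by
  induction. Blocks \<open>0, \<dots>, n div h\<close> suffice.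
\<close>

lemma card_separated_le_of_rare_choices:
  fixes F :: "'a::metric_space \<Rightarrow> 'a" and code :: "'a \<Rightarrow> 'b" and B :: "'a set"
  assumes inv: "\<And>x. x \<in> X \<Longrightarrow> F x \<in> X"
    and fin: "finite (code ` X)"
    and close: "\<And>x y. x \<in> X \<Longrightarrow> y \<in> X \<Longrightarrow> code x = code y \<Longrightarrow> dist x y \<le> \<epsilon>"
    and saturated: "\<And>x y. x \<in> X \<Longrightarrow> y \<in> X \<Longrightarrow> code x = code y \<Longrightarrow> x \<in> B \<Longrightarrow> y \<in> B"
    and determined: "\<And>x y. x \<in> X \<Longrightarrow> y \<in> X \<Longrightarrow> code x = code y \<Longrightarrow> x \<notin> B \<Longrightarrow>
                        code (F x) = code (F y)"
    and S: "finite S" "S \<noteq> {}" "\<And>x. x \<in> X \<Longrightarrow> x \<in> B \<Longrightarrow> code (F x) \<in> S"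
    and gap: "\<And>x j. x \<in> X \<Longrightarrow> x \<in> B \<Longrightarrow> 0 < j \<Longrightarrow> j < h \<Longrightarrow> (F ^^ j) x \<notin> B"
    and "h > 0"
    and E: "orbit_separated X F n \<epsilon> E"
  shows "card E \<le> card (code ` X) * card S ^ (n div h + 1)"
proof -
  define visits where "visits = (\<lambda>x i j. j div h = i \<and> (F ^^ j) x \<in> B)"
  \<comment> \<open>In blocks without a visit the recorded value carries no information; an arbitrary element
      of \<open>S\<close> keeps all records inside \<open>S\<close>.\<close>
  define choice where "choice = (\<lambda>x i. if \<exists>j. visits x i j
      then code ((F ^^ Suc (SOME j. visits x i j)) x) else (SOME s. s \<in> S))"
  define K where "K = {..<n div h + 1}"
  have orbit: "(F ^^ j) x \<in> X" if "x \<in> X" for x j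
    by (induction j) (use that inv in auto)
  have unique_le: "\<not> (j < j' \<and> visits x i j \<and> visits x i j')" if "x \<in> X" for x i j j'
  proof
    assume *: "j < j' \<and> visits x i j \<and> visits x i j'"
    have "j' - j < h"
    proof -
      have "j' = i * h + j' mod h" "j = i * h + j mod h"
        using * div_mult_mod_eq[of j' h] div_mult_mod_eq[of j h] by (auto simp: visits_def)
      thus ?thesis using \<open>h > 0\<close> mod_less_divisor[of h j'] by linarith
    qed
    moreover have "(F ^^ (j' - j)) ((F ^^ j) x) = (F ^^ j') x"
      using * funpow_add[of "j' - j" j F] by simp
    ultimately show False
      using * gap[of "(F ^^ j) x" "j' - j"] orbit[OF that] by (auto simp: visits_def)
  qed
  have unique: "j = j'" if "x \<in> X" "visits x i j" "visits x i j'" for x i j j'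
    using unique_le[OF that(1)] that(2,3) by (meson linorder_neqE_nat)
  \<comment> \<open>Uniqueness makes \<open>choice\<close> the code after whatever visit is at hand, so that two orbits with
      the same record also agree after a visit.\<close>
  have choice_eq: "choice x i = code ((F ^^ Suc j) x)" if "x \<in> X" "visits x i j" for x i j
  proof -
    have "(SOME j. visits x i j) = j" using that by (intro some_equality) (auto intro: unique)
    thus ?thesis using that(2) by (auto simp: choice_def)
  qed
  have choice_in: "choice x i \<in> S" if "x \<in> X" for x i
  proof (cases "\<exists>j. visits x i j")
    case True
    then obtain j where j: "visits x i j" by blast
    show ?thesis unfolding choice_eq[OF that j]
      using S(3)[OF orbit[OF that]] j by (auto simp: visits_def)
  next
    case False
    thus ?thesis using S(2) unfolding choice_def by (subst if_not_P) (auto simp: some_in_eq)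
  qed
  have same_codes: "code ((F ^^ j) x) = code ((F ^^ j) y)"
    if xy: "x \<in> X" "y \<in> X" "code x = code y" "\<And>i. i \<in> K \<Longrightarrow> choice x i = choice y i" and "j \<le> n"
    for x y j
    using \<open>j \<le> n\<close>
  proof (induction j)
    case 0
    thus ?case using xy by simp
  next
    case (Suc j)
    hence IH: "code ((F ^^ j) x) = code ((F ^^ j) y)" by simp
    show ?case
    proof (cases "(F ^^ j) x \<in> B")
      case False
      thus ?thesis using determined[OF orbit orbit IH] xy by simp
    next
      case True
      hence "(F ^^ j) y \<in> B" using saturated[OF orbit orbit IH] xy by simp
      hence "visits x (j div h) j" "visits y (j div h) j" using True by (auto simp: visits_def)
      moreover have "j div h \<in> K" using Suc.prems by (simp add: K_def div_le_mono less_Suc_eq_le)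
      ultimately show ?thesis using choice_eq xy by metis
    qed
  qed
  define itinerary where "itinerary = (\<lambda>x. (code x, restrict (choice x) K))"
  have EX: "E \<subseteq> X" using E by (simp add: orbit_separated_def)
  have "inj_on itinerary E"
  proof (rule inj_onI, rule ccontr)
    fix x y assume xy: "x \<in> E" "y \<in> E" "itinerary x = itinerary y" "x \<noteq> y"
    then obtain j where j: "j < n" "dist ((F ^^ j) x) ((F ^^ j) y) > \<epsilon>"
      using E unfolding orbit_separated_def by blast
    have "code x = code y" "\<And>i. i \<in> K \<Longrightarrow> choice x i = choice y i"
      using xy(3) unfolding itinerary_def by (simp, metis prod.inject restrict_apply')
    hence "code ((F ^^ j) x) = code ((F ^^ j) y)"
      using same_codes[of x y j] xy EX j by auto
    hence "dist ((F ^^ j) x) ((F ^^ j) y) \<le> \<epsilon>" using close orbit xy EX by blast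
    thus False using j by simp
  qed
  moreover have "itinerary ` E \<subseteq> code ` X \<times> (K \<rightarrow>\<^sub>E S)"
    using EX choice_in by (auto simp: itinerary_def)
  moreover have "finite (code ` X \<times> (K \<rightarrow>\<^sub>E S))"
    using fin S by (auto simp: K_def intro: finite_PiE)
  ultimately have "card E \<le> card (code ` X \<times> (K \<rightarrow>\<^sub>E S))" by (rule card_inj_on_le)
  also have "\<dots> = card (code ` X) * card S ^ (n div h + 1)"
    by (simp add: card_cartesian_product card_PiE K_def)
  finally show ?thesis .
qed

lemma separated_growth_le_of_card_le:
  assumes card_le: "\<And>n E. orbit_separated X F n \<epsilon> E \<Longrightarrow> card E \<le> C * m ^ (n div h + 1)"
    and "C > 0" "m > 0" "h > 0"
  shows "separated_growth X F \<epsilon> \<le> ereal (ln (real m) / real h)"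
proof -
  define b where "b = (\<lambda>n. (ln (real C) + ln (real m)) / real n + ln (real m) / real h)"
  have bound: "ereal (1 / real n) * ln_enat (max_separated X F n \<epsilon>) \<le> ereal (b n)" if "n > 0" for n
  proof -
    have "max_separated X F n \<epsilon> \<le> enat (C * m ^ (n div h + 1))"
      unfolding max_separated_def by (rule SUP_least) (use card_le in auto)
    then obtain k where k: "max_separated X F n \<epsilon> = enat k" "k \<le> C * m ^ (n div h + 1)"
      by (cases "max_separated X F n \<epsilon>") auto
    show ?thesis
    proof (cases "k = 0")
      case True
      thus ?thesis using k that by (simp add: ln_enat_def zero_enat_def)
    next
      case False
      have "real k \<le> real C * real m ^ (n div h + 1)"
        using k(2) by (metis of_nat_le_iff of_nat_mult of_nat_power)
      hence "ln (real k) \<le> ln (real C * real m ^ (n div h + 1))"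
        using False by (subst ln_le_cancel_iff) (use assms in auto)
      also have "\<dots> = ln (real C) + real (n div h + 1) * ln (real m)"
        using assms by (subst ln_mult) (auto simp: ln_realpow simp del: power_Suc power_add)
      also have "\<dots> \<le> ln (real C) + (real n / real h + 1) * ln (real m)"
        using assms of_nat_div_le_of_nat[of n h] by (intro add_left_mono mult_right_mono) auto
      also have "\<dots> = real n * b n"
        using that by (simp add: b_def field_simps)
      finally have "1 / real n * ln (real k) \<le> b n"
        using that by (simp add: field_simps)
      thus ?thesis using False k(1) by (simp add: ln_enat_def)
    qed
  qed
  have "b \<longlonglongrightarrow> 0 + ln (real m) / real h"
    unfolding b_def by (intro tendsto_add lim_const_over_n tendsto_const)
  hence "limsup (\<lambda>n. ereal (b n)) = ereal (ln (real m) / real h)"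
    by (intro lim_imp_Limsup) auto
  moreover have "separated_growth X F \<epsilon> \<le> limsup (\<lambda>n. ereal (b n))"
    unfolding separated_growth_def
    by (intro Limsup_mono eventually_mono[OF eventually_gt_at_top[of 0]] bound)
  ultimately show ?thesis by simp
qed

text \<open>A single point is always a separated set.\<close>

lemma separated_growth_nonneg:
  assumes "X \<noteq> {}"
  shows "separated_growth X F \<epsilon> \<ge> 0"
proof -
  obtain x where x: "x \<in> X" using assms by blast
  have "0 \<le> ereal (1 / real n) * ln_enat (max_separated X F n \<epsilon>)" for n
  proof -
    have "enat (card {x}) \<le> max_separated X F n \<epsilon>"
      unfolding max_separated_def by (rule SUP_upper) (use x in \<open>auto simp: orbit_separated_def\<close>)
    hence "0 \<le> ln_enat (max_separated X F n \<epsilon>)"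
      by (auto simp: ln_enat_def one_enat_def split: enat.splits)
    thus ?thesis by simp
  qed
  thus ?thesis unfolding separated_growth_def
    by (intro le_Limsup) auto
qed

lemma bowen_entropy_zero:
  assumes "X \<noteq> {}" and "\<And>\<epsilon>. \<epsilon> > 0 \<Longrightarrow> separated_growth X F \<epsilon> \<le> 0"
  shows "bowen_entropy X F = 0"
proof -
  have "separated_growth X F \<epsilon> = 0" if "\<epsilon> > 0" for \<epsilon>
    using assms separated_growth_nonneg that by (metis antisym)
  hence "\<forall>\<^sub>F \<epsilon> in at_right 0. separated_growth X F \<epsilon> = 0"
    using eventually_at_right_less[of "0::real"] by (auto elim: eventually_mono)
  hence "(separated_growth X F \<longlongrightarrow> 0) (at_right 0)" by (rule tendsto_eventually)
  thus ?thesis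
    using bowen_entropy_tendsto[of X F] tendsto_unique[OF trivial_limit_at_right_real] by blast
qed

section \<open>Rotated odometers near the origin\<close>

text \<open>
  Right continuity in the strong form that piecewise translations have. Unlike right continuity
  it is stable under composition: the image of a right neighbourhood is again a right neighbourhood.
\<close>

definition right_translation_at :: "real \<Rightarrow> (real \<Rightarrow> real) \<Rightarrow> bool" where
  "right_translation_at x f \<longleftrightarrow> (\<exists>\<delta>>0. \<forall>t. 0 \<le> t \<and> t < \<delta> \<longrightarrow> f (x + t) = f x + t)"

lemma right_translation_at_comp:
  assumes "right_translation_at x f" "right_translation_at (f x) g"
  shows "right_translation_at x (g \<circ> f)"
proof -
  obtain \<delta> \<delta>' where "\<delta> > 0" "\<forall>t. 0 \<le> t \<and> t < \<delta> \<longrightarrow> f (x + t) = f x + t"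
    "\<delta>' > 0" "\<forall>t. 0 \<le> t \<and> t < \<delta>' \<longrightarrow> g (f x + t) = g (f x) + t"
    using assms unfolding right_translation_at_def by blast
  thus ?thesis
    unfolding right_translation_at_def by (intro exI[of _ "min \<delta> \<delta>'"]) auto
qed

lemma right_translation_at_kakutani:
  assumes "x \<in> {0..<1}"
  shows "right_translation_at x kakutani"
proof -
  obtain n where n: "n \<ge> 1" "x \<in> {1 - 2 / 2 ^ n ..< 1 - 1 / 2 ^ n}"
    using kakutani_index_exists[OF assms] by blast
  have "kakutani (x + t) = kakutani x + t" if "0 \<le> t" "t < 1 - 1 / 2 ^ n - x" for t
    using kakutani_eq[OF n] kakutani_eq[OF n(1), of "x + t"] n(2) that by simp
  thus ?thesis unfolding right_translation_at_def
    using n(2) by (intro exI[of _ "1 - 1 / 2 ^ n - x"]) auto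
qed

lemma in_interval_of_index:
  assumes "q \<ge> 1" "x \<ge> 0"
  shows "x \<in> {real (nat \<lfloor>real q * x\<rfloor>) / real q ..< (real (nat \<lfloor>real q * x\<rfloor>) + 1) / real q}"
proof -
  have "0 \<le> real q * x" using assms by simp
  hence "real (nat \<lfloor>real q * x\<rfloor>) \<le> real q * x" "real q * x < real (nat \<lfloor>real q * x\<rfloor>) + 1"
    using of_nat_floor floor_correct[of "real q * x"] by linarith+
  thus ?thesis using assms(1) by (auto simp: field_simps)
qed

lemma right_translation_at_interval_perm:
  assumes "q \<ge> 1" "x \<ge> 0"
  shows "right_translation_at x (interval_perm q \<pi>)"
proof -
  define i where "i = nat \<lfloor>real q * x\<rfloor>"
  have x: "x \<in> {real i / real q ..< (real i + 1) / real q}"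
    unfolding i_def by (rule in_interval_of_index[OF assms])
  have "interval_perm q \<pi> (x + t) = interval_perm q \<pi> x + t"
    if "0 \<le> t" "t < (real i + 1) / real q - x" for t
    using interval_perm_eq[OF assms(1) x, of \<pi>]
      interval_perm_eq[OF assms(1), of "x + t" i \<pi>] x that by auto
  thus ?thesis unfolding right_translation_at_def
    using x by (intro exI[of _ "(real i + 1) / real q - x"]) auto
qed

lemma interval_perm_in_I:
  assumes "q \<ge> 1" "\<pi> permutes {0..<q}" "x \<in> {0..<1}"
  shows "interval_perm q \<pi> x \<in> {0..<1}"
proof -
  define i where "i = nat \<lfloor>real q * x\<rfloor>"
  have q: "real q > 0" using assms(1) by simp
  have fl: "real i \<le> real q * x" "real q * x < real i + 1"
    using in_interval_of_index[OF assms(1), of x] assms(3) q by (auto simp: i_def field_simps)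
  have "real q * x < real q * 1" using assms(3) q by (intro mult_strict_left_mono) auto
  hence "i < q" using fl(1) by linarith
  hence "\<pi> i < q" using permutes_in_image[OF assms(2), of i] by simp
  hence *: "real (\<pi> i) + 1 \<le> real q" by linarith
  have "real q * interval_perm q \<pi> x = real q * x - real i + real (\<pi> i)"
    using q unfolding interval_perm_def Let_def i_def[symmetric] by (simp add: field_simps)
  hence "0 \<le> real q * interval_perm q \<pi> x" "real q * interval_perm q \<pi> x < real q * 1"
    using fl * by linarith+
  thus ?thesis using q by (simp add: zero_le_mult_iff)
qed

lemma right_translation_at_rotated_odometer_orbit:
  assumes q: "q \<ge> 1" "\<pi> permutes {0..<q}" and x: "x \<in> {0..<1}"
  shows "right_translation_at x (interval_perm q \<pi> \<circ> (rotated_odometer q \<pi> ^^ j))"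
proof -
  let ?F = "rotated_odometer q \<pi>"
  have orbit: "(?F ^^ j) x \<in> {0..<1}" for j
    by (induction j) (use x rotated_odometer_in_I[OF q] in auto)
  have step: "right_translation_at y ?F" if "y \<in> {0..<1}" for y
    unfolding rotated_odometer_def using that interval_perm_in_I[OF q that]
    by (intro right_translation_at_comp right_translation_at_interval_perm
        right_translation_at_kakutani) (use q in auto)
  have "right_translation_at x (?F ^^ j)"
  proof (induction j)
    case 0
    show ?case unfolding right_translation_at_def by (auto intro: exI[of _ 1])
  next
    case (Suc j)
    thus ?case using right_translation_at_comp[OF Suc step[OF orbit]] by (simp add: comp_def)
  qed
  thus ?thesis
    using orbit[of j] q by (intro right_translation_at_comp right_translation_at_interval_perm) auto
qed

text \<open>
  The images of \<open>0\<close> under the finitely many maps \<open>R \<circ> F\<^sup>j\<close> have a positive distance from \<open>1\<close>, and nearby points on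
  the right of \<open>0\<close> move along with \<open>0\<close>. One \<open>\<delta>\<close> for both the size of the neighbourhood and the distance
  from \<open>1\<close> is convenient because later the single scale \<open>2\<^bsup>-N\<^esup>\<close> has to be small against both.
\<close>

lemma long_excursion_from_origin:
  assumes q: "q \<ge> 1" "\<pi> permutes {0..<q}"
  obtains \<delta> where "\<delta> > 0"
    and "\<And>x j. 0 \<le> x \<Longrightarrow> x < \<delta> \<Longrightarrow> j < h \<Longrightarrow>
           interval_perm q \<pi> ((rotated_odometer q \<pi> ^^ j) x) < 1 - \<delta>"
proof -
  let ?G = "\<lambda>j. interval_perm q \<pi> \<circ> (rotated_odometer q \<pi> ^^ j)"
  have "\<exists>\<delta>>0. \<forall>x. 0 \<le> x \<and> x < \<delta> \<longrightarrow> ?G j x < 1 - \<delta>" for j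
  proof -
    obtain \<delta> where \<delta>: "\<delta> > 0" "\<forall>t. 0 \<le> t \<and> t < \<delta> \<longrightarrow> ?G j (0 + t) = ?G j 0 + t"
      using right_translation_at_rotated_odometer_orbit[OF q, of 0 j]
      unfolding right_translation_at_def by auto
    have "(rotated_odometer q \<pi> ^^ j) 0 \<in> {0..<1}"
      by (induction j) (use rotated_odometer_in_I[OF q] in auto)
    hence less: "?G j 0 < 1" using interval_perm_in_I[OF q] by auto
    define v where "v = ?G j 0"
    have v: "v < 1" using less by (simp only: v_def)
    define \<eta> where "\<eta> = min \<delta> ((1 - v) / 2)"
    have "\<eta> > 0" using \<delta>(1) v by (simp add: \<eta>_def)
    moreover have "?G j x < 1 - \<eta>" if x: "0 \<le> x" "x < \<eta>" for x
    proof -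
      have \<eta>: "x < \<delta>" "x < (1 - v) / 2" "\<eta> \<le> (1 - v) / 2"
        using x unfolding \<eta>_def by linarith+
      have "?G j x = v + x" using \<delta>(2) x(1) \<eta>(1) unfolding v_def by (metis add_0)
      also have "\<dots> < 1 - \<eta>" using \<eta>(2,3) by (simp add: field_simps)
      finally show ?thesis .
    qed
    ultimately show ?thesis by blast
  qed
  then obtain d where d: "\<And>j. d j > 0" "\<And>j x. 0 \<le> x \<Longrightarrow> x < d j \<Longrightarrow> ?G j x < 1 - d j"
    by metis
  define \<delta> where "\<delta> = Min (insert 1 (d ` {..<h}))"
  have le: "\<delta> \<le> d j" if "j < h" for j using that by (auto simp: \<delta>_def)
  have "\<delta> > 0" using d(1) by (auto simp: \<delta>_def)
  moreover have "interval_perm q \<pi> ((rotated_odometer q \<pi> ^^ j) x) < 1 - \<delta>"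
    if "0 \<le> x" "x < \<delta>" "j < h" for x j
    using d(2)[of x j] le[of j] that by auto
  ultimately show ?thesis using that by blast
qed

section \<open>The grid coding of a rotated odometer\<close>

text \<open>
  Two points are in the same cell of the grid of mesh \<open>1/M\<close> iff \<open>\<lfloor>M x\<rfloor>\<close> agrees. Grid points
  are the \<open>t\<close> with \<open>M t\<close> an integer; they do not cut cells, and translations by them preserve the grid.
\<close>

lemma floor_eq_imp_less_iff:
  fixes x y t M :: real
  assumes "\<lfloor>M * x\<rfloor> = \<lfloor>M * y\<rfloor>" "M * t \<in> \<int>" "M > 0"
  shows "x < t \<longleftrightarrow> y < t"
proof -
  obtain k where k: "M * t = of_int k" using assms(2) by (elim Ints_cases)
  have "z < t \<longleftrightarrow> \<lfloor>M * z\<rfloor> < k" for z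
    using mult_less_cancel_left_pos[OF assms(3), of z t] by (simp add: k floor_less_iff)
  thus ?thesis using assms(1) by simp
qed

lemma floor_eq_imp_floor_shift_eq:
  fixes x y d M :: real
  assumes "\<lfloor>M * x\<rfloor> = \<lfloor>M * y\<rfloor>" "M * d \<in> \<int>"
  shows "\<lfloor>M * (x + d)\<rfloor> = \<lfloor>M * (y + d)\<rfloor>"
proof -
  obtain k where k: "M * d = of_int k" using assms(2) by (elim Ints_cases)
  show ?thesis using assms(1) by (simp add: distrib_left k)
qed

text \<open>
  The grid refines the intervals of length \<open>1/q\<close>, so points of one cell are moved by the same multiple
  of \<open>1/q\<close>.
\<close>

lemma floor_interval_perm_eq:
  assumes "q \<ge> 1" "\<lfloor>real (q * 2 ^ N) * x\<rfloor> = \<lfloor>real (q * 2 ^ N) * y\<rfloor>"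
  shows "\<lfloor>real (q * 2 ^ N) * interval_perm q \<pi> x\<rfloor> = \<lfloor>real (q * 2 ^ N) * interval_perm q \<pi> y\<rfloor>"
proof -
  have floor_q: "\<lfloor>real q * z\<rfloor> = \<lfloor>real (q * 2 ^ N) * z\<rfloor> div 2 ^ N" for z
    using floor_divide_real_eq_div[of "2 ^ N" "real (q * 2 ^ N) * z"] by simp
  define i where "i = nat \<lfloor>real q * x\<rfloor>"
  define d where "d = real (\<pi> i) / real q - real i / real q"
  have "interval_perm q \<pi> x = x + d" "interval_perm q \<pi> y = y + d"
    using assms(2) by (simp_all add: interval_perm_def d_def i_def floor_q Let_def)
  moreover have "real (q * 2 ^ N) * d = of_int ((int (\<pi> i) - int i) * 2 ^ N)"
    using assms(1) by (simp add: d_def field_simps)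
  hence "real (q * 2 ^ N) * d \<in> \<int>" by (metis Ints_of_int)
  ultimately show ?thesis using floor_eq_imp_floor_shift_eq[OF assms(2)] by simp
qed

text \<open>
  Below \<open>1 - 2\<^bsup>-N\<^esup>\<close> only the pieces of the Kakutani map with index \<open>n \<le> N\<close> occur, and their end points and
  translation lengths are multiples of \<open>2\<^bsup>-N\<^esup>\<close>.
\<close>

lemma floor_kakutani_eq:
  assumes q: "q \<ge> 1" and x: "x \<in> {0..<1}" "x < 1 - 1 / 2 ^ N"
    and same: "\<lfloor>real (q * 2 ^ N) * x\<rfloor> = \<lfloor>real (q * 2 ^ N) * y\<rfloor>"
  shows "\<lfloor>real (q * 2 ^ N) * kakutani x\<rfloor> = \<lfloor>real (q * 2 ^ N) * kakutani y\<rfloor>"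
proof -
  let ?M = "real (q * 2 ^ N)"
  obtain n :: nat where n: "n \<ge> 1" "x \<in> {1 - 2 / 2 ^ n ..< 1 - 1 / 2 ^ n}"
    using kakutani_index_exists[OF x(1)] by blast
  have "n \<le> N"
  proof (rule ccontr)
    assume "\<not> n \<le> N"
    hence "(2::real) ^ Suc N \<le> 2 ^ n" by (intro power_increasing) auto
    hence "2 / (2::real) ^ n \<le> 2 / 2 ^ Suc N" by (intro divide_left_mono) auto
    thus False using n(2) x(2) by simp
  qed
  have grid: "?M * (1 - of_int k / 2 ^ n) \<in> \<int>" for k :: int
  proof -
    have "?M * (1 - of_int k / 2 ^ n) = real q * 2 ^ N - real q * of_int k * 2 ^ (N - n)"
      using \<open>n \<le> N\<close> by (simp add: power_diff field_simps)
    thus ?thesis by simp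
  qed
  have M: "?M > 0" using q by simp
  have "y \<in> {1 - 2 / 2 ^ n ..< 1 - 1 / 2 ^ n}"
    using floor_eq_imp_less_iff[OF same _ M, of "1 - 2 / 2 ^ n"]
      floor_eq_imp_less_iff[OF same _ M, of "1 - 1 / 2 ^ n"] grid[of 2] grid[of 1] n(2) by auto
  hence "kakutani x = x + - (1 - 3 / 2 ^ n)" "kakutani y = y + - (1 - 3 / 2 ^ n)"
    using kakutani_eq[OF n(1)] n(2) by auto
  moreover have "?M * - (1 - 3 / 2 ^ n) \<in> \<int>"
    using grid[of 3] by (simp only: mult_minus_right minus_in_Ints_iff of_int_numeral)
  ultimately show ?thesis using floor_eq_imp_floor_shift_eq[OF same] by simp
qed

text \<open>
  The infinitely many pieces of index \<open>n > N\<close> are carried into \<open>{0..<2\<^bsup>-N\<^esup>}\<close>: the piece of index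
  \<open>n\<close> goes to \<open>{2\<^bsup>-n\<^esup>..<2 \<cdot> 2\<^bsup>-n\<^esup>}\<close>.
\<close>

lemma kakutani_top_interval:
  assumes "x \<in> {0..<1}" "x \<ge> 1 - 1 / 2 ^ N"
  shows "kakutani x \<in> {0..<1 / 2 ^ N}"
proof -
  obtain n :: nat where n: "n \<ge> 1" "x \<in> {1 - 2 / 2 ^ n ..< 1 - 1 / 2 ^ n}"
    using kakutani_index_exists[OF assms(1)] by blast
  have "N < n"
  proof (rule ccontr)
    assume "\<not> N < n"
    hence "(2::real) ^ n \<le> 2 ^ N" by (intro power_increasing) auto
    hence "1 / (2::real) ^ N \<le> 1 / 2 ^ n" by (intro divide_left_mono) auto
    thus False using n(2) assms(2) by simp
  qed
  hence "(2::real) ^ Suc N \<le> 2 ^ n" by (intro power_increasing) auto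
  hence "2 / (2::real) ^ n \<le> 2 / 2 ^ Suc N" by (intro divide_left_mono) auto
  hence "2 / (2::real) ^ n \<le> 1 / 2 ^ N" by simp
  moreover have "3 / (2::real) ^ n = 2 / 2 ^ n + 1 / 2 ^ n" "1 / (2::real) ^ n > 0"
    by (simp_all add: field_simps)
  ultimately show ?thesis using n(2) kakutani_eq[OF n] by auto
qed

text \<open>
  The coding by grid cells meets the requirements of \<open>card_separated_le_of_rare_choices\<close> once \<open>2\<^bsup>-N\<^esup>\<close> is
  smaller than \<open>\<epsilon>\<close>, which makes points of one cell \<open>\<epsilon>\<close>-close, and smaller than the \<open>\<delta>\<close> of the
  excursion of length \<open>h\<close>. The number of choices is \<open>q\<close> for every \<open>N\<close>, since \<open>{0..<2\<^bsup>-N\<^esup>}\<close> always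
  consists of \<open>q\<close> cells; so the bound does not depend on \<open>\<epsilon>\<close>.
\<close>

lemma separated_growth_rotated_odometer_le:
  assumes q: "q \<ge> 1" "\<pi> permutes {0..<q}" and "\<epsilon> > 0" "h > 0"
  shows "separated_growth {0..<1} (rotated_odometer q \<pi>) \<epsilon> \<le> ereal (ln (real q) / real h)"
proof -
  let ?F = "rotated_odometer q \<pi>" and ?R = "interval_perm q \<pi>"
  obtain \<delta> where \<delta>: "\<delta> > 0" "\<And>x j. 0 \<le> x \<Longrightarrow> x < \<delta> \<Longrightarrow> j < h \<Longrightarrow> ?R ((?F ^^ j) x) < 1 - \<delta>"
    using long_excursion_from_origin[OF q] by blast
  obtain N :: nat where "(1 / 2) ^ N < min \<delta> \<epsilon>"
    using real_arch_pow_inv[of "min \<delta> \<epsilon>" "1 / 2"] \<delta>(1) \<open>\<epsilon> > 0\<close> by auto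
  hence N: "1 / 2 ^ N < \<delta>" "1 / 2 ^ N < \<epsilon>" by (auto simp: power_one_over)
  define M where "M = real (q * 2 ^ N)"
  define code where "code = (\<lambda>x. \<lfloor>M * x\<rfloor>)"
  define B where "B = {x. ?R x \<ge> 1 - 1 / 2 ^ N}"
  have M: "M > 0" "M \<ge> 2 ^ N" using q(1) by (simp_all add: M_def)
  have M_cell: "M * (1 - 1 / 2 ^ N) \<in> \<int>"
  proof -
    have "M * (1 - 1 / 2 ^ N) = real q * 2 ^ N - real q" by (simp add: M_def field_simps)
    thus ?thesis by simp
  qed
  have code_R: "code (?R x) = code (?R y)" if "code x = code y" for x y
    using floor_interval_perm_eq[OF q(1)] that unfolding code_def M_def by blast
  have FB: "?F x \<in> {0..<1 / 2 ^ N}" if "x \<in> {0..<1}" "x \<in> B" for x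
    using kakutani_top_interval[OF interval_perm_in_I[OF q that(1)]] that(2)
    by (simp add: B_def rotated_odometer_def)
  have code_range: "code ` {0..<1} \<subseteq> {0..<int (q * 2 ^ N)}"
  proof safe
    fix x :: real assume "x \<in> {0..<1}"
    hence "M * x \<ge> 0" "M * x < M * 1"
      using M(1) by (auto intro: mult_strict_left_mono simp del: mult_1_right)
    thus "code x \<in> {0..<int (q * 2 ^ N)}" by (simp add: code_def M_def floor_less_iff)
  qed
  have fin: "finite (code ` {0..<1})" using code_range finite_subset by blast
  have "card E \<le> card (code ` {0..<1}) * card {0..<int q} ^ (n div h + 1)"
    if E: "orbit_separated {0..<1} ?F n \<epsilon> E" for n E
  proof (rule card_separated_le_of_rare_choices[OF rotated_odometer_in_I[OF q] fin _ _ _ _ _ _ _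
        \<open>h > 0\<close> E, where B = B])
    fix x y :: real assume xy: "x \<in> {0..<1}" "y \<in> {0..<1}" "code x = code y"
    have "\<bar>M * x - M * y\<bar> < 1" using xy(3) unfolding code_def by linarith
    hence "M * \<bar>x - y\<bar> < 1" using M(1) by (simp add: abs_mult flip: right_diff_distrib)
    moreover have "2 ^ N * \<bar>x - y\<bar> \<le> M * \<bar>x - y\<bar>" using M(2) by (intro mult_right_mono) auto
    ultimately have "\<bar>x - y\<bar> < 1 / 2 ^ N" by (simp add: field_simps)
    thus "dist x y \<le> \<epsilon>" using N(2) by (simp add: dist_real_def)
    have top: "?R x < 1 - 1 / 2 ^ N \<longleftrightarrow> ?R y < 1 - 1 / 2 ^ N"
      by (rule floor_eq_imp_less_iff[OF code_R[OF xy(3), unfolded code_def] M_cell M(1)])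
    show "y \<in> B" if "x \<in> B" using that top by (auto simp: B_def)
    show "code (?F x) = code (?F y)" if "x \<notin> B"
      using floor_kakutani_eq[OF q(1) interval_perm_in_I[OF q xy(1)], of N "?R y"]
        code_R[OF xy(3)] that by (simp add: B_def rotated_odometer_def code_def M_def)
  next
    show "finite {0..<int q}" "{0..<int q} \<noteq> {}" using q(1) by auto
  next
    fix x :: real assume "x \<in> {0..<1}" "x \<in> B"
    hence F: "0 \<le> ?F x" "?F x < 1 / 2 ^ N" using FB by auto
    have "M * ?F x < M * (1 / 2 ^ N)" using F M(1) by (intro mult_strict_left_mono) auto
    also have "\<dots> = real q" by (simp add: M_def)
    finally show "code (?F x) \<in> {0..<int q}" using F M(1) by (simp add: code_def floor_less_iff)
  next
    fix x :: real and j :: nat assume x: "x \<in> {0..<1}" "x \<in> B" and j: "0 < j" "j < h"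
    \<comment> \<open>The excursion starts at \<open>F x\<close>, one step after the visit to \<open>B\<close>.\<close>
    obtain i where i: "j = Suc i" using j(1) gr0_implies_Suc by blast
    have "?R ((?F ^^ i) (?F x)) < 1 - \<delta>" using FB[OF x] N(1) i j by (intro \<delta>(2)) auto
    thus "(?F ^^ j) x \<notin> B" using N(1) by (simp add: B_def i funpow_Suc_right del: funpow.simps)
  qed
  moreover have "card (code ` {0..<1}) > 0" using fin by (simp add: card_gt_0_iff)
  ultimately show ?thesis
    using separated_growth_le_of_card_le[of "{0..<1}" ?F \<epsilon> "card (code ` {0..<1})" q h] q(1) \<open>h > 0\<close>
    by simp
qed

theorem theorem1p5:
  fixes q :: nat and \<pi> :: "nat \<Rightarrow> nat"
  assumes "q \<ge> 1" and "\<pi> permutes {0..<q}"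
  shows "bowen_entropy {0..<1} (rotated_odometer q \<pi>) = 0"
proof (rule bowen_entropy_zero)
  fix \<epsilon> :: real assume "\<epsilon> > 0"
  have "(\<lambda>h. ereal (ln (real q) / real h)) \<longlonglongrightarrow> ereal 0"
    by (intro tendsto_ereal lim_const_over_n)
  moreover have "\<forall>\<^sub>F h in sequentially.
      separated_growth {0..<1} (rotated_odometer q \<pi>) \<epsilon> \<le> ereal (ln (real q) / real h)"
    using eventually_gt_at_top[of 0]
    by eventually_elim (rule separated_growth_rotated_odometer_le[OF assms \<open>\<epsilon> > 0\<close>])
  ultimately show "separated_growth {0..<1} (rotated_odometer q \<pi>) \<epsilon> \<le> 0"
    unfolding zero_ereal_def by (rule tendsto_lowerbound) simp
qed auto

end
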